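(* For $i=1,2$ let $H_i,K_i\in(0,1)$ with $H_iK_i\le\frac12$, and let $\{X^i(t),\,0\le t\le 1\}$ be a trifractional Brownian motion with Hurst indices $(H_i,K_i)$. Suppose that $H_1K_1\neq H_2K_2$. Let $P_i$ be the probability measure generated by the process $\{X^i(t),\,0\le t\le 1\}$, $i=1,2$. Then the probability measures $P_1$ and $P_2$ are singular with respect to each other.
   Context: A trifractional Brownian motion on $[0,1]$ with Hurst indices $(H,K)$, where $H,K\in(0,1)$, is a centered Gaussian process $\{Z_{H,K}(t),\ t\in[0,1]\}$ with covariance function $$C_{H,K}(s,t)=t^{2HK}+s^{2HK}-(t^{2H}+s^{2H})^K,\qquad 0\le s,t\le 1.$$ The probability measure generated by a process $\{X(t),\,t\in[0,1]\}$ is its law on the path space $\mathbb{R}^{[0,1]}$ equipped with the $\sigma$-algebra generated by the coordinate maps. Two probability measures $P,Q$ on the same measurable space are singular with respect to each other if there is a measurable set $A$ with $P(A)=1$ and $Q(A)=0$. *)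

theory Defs
  imports "HOL-Probability.Probability"
begin

(* The degenerate case is a separate branch: for \<sigma> = 0 the library's normal_density is the zero
   function, whereas N(m, 0) is the point mass at m. *)
definition normal_law :: "real \<Rightarrow> real \<Rightarrow> real measure" where
  "normal_law m \<sigma> =
     (if \<sigma> = 0 then return borel m else density lborel (\<lambda>x. ennreal (normal_density m \<sigma> x)))"

definition gaussian_rv :: "'a measure \<Rightarrow> ('a \<Rightarrow> real) \<Rightarrow> bool" where
  "gaussian_rv M Y \<longleftrightarrow>
     Y \<in> borel_measurable M \<and> (\<exists>m \<sigma>. 0 \<le> \<sigma> \<and> distr M borel Y = normal_law m \<sigma>)"

(* Joint Gaussianity of the finite-dimensional distributions, possibly degenerate: all finite linear
   combinations of the process are Gaussian. *)
definition gaussian_process :: "'a measure \<Rightarrow> 'i set \<Rightarrow> ('i \<Rightarrow> 'a \<Rightarrow> real) \<Rightarrow> bool" where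
  "gaussian_process M T X \<longleftrightarrow>
     prob_space M \<and>
     (\<forall>J c. finite J \<and> J \<subseteq> T \<longrightarrow> gaussian_rv M (\<lambda>\<omega>. \<Sum>t\<in>J. c t * X t \<omega>))"

definition covariance :: "'a measure \<Rightarrow> ('a \<Rightarrow> real) \<Rightarrow> ('a \<Rightarrow> real) \<Rightarrow> real" where
  "covariance M Y Z =
     (\<integral>\<omega>. (Y \<omega> - (\<integral>\<omega>'. Y \<omega>' \<partial>M)) * (Z \<omega> - (\<integral>\<omega>'. Z \<omega>' \<partial>M)) \<partial>M)"

definition centered_gaussian_process ::
    "'a measure \<Rightarrow> 'i set \<Rightarrow> ('i \<Rightarrow> 'a \<Rightarrow> real) \<Rightarrow> ('i \<Rightarrow> 'i \<Rightarrow> real) \<Rightarrow> bool" where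
  "centered_gaussian_process M T X C \<longleftrightarrow>
     gaussian_process M T X \<and>
     (\<forall>t\<in>T. (\<integral>\<omega>. X t \<omega> \<partial>M) = 0) \<and>
     (\<forall>s\<in>T. \<forall>t\<in>T. covariance M (X s) (X t) = C s t)"

(* Since 0 powr a = 0, the value at s = t = 0 is 0, as it should be for H, K > 0. *)
definition tfBm_cov :: "real \<Rightarrow> real \<Rightarrow> real \<Rightarrow> real \<Rightarrow> real" where
  "tfBm_cov H K s t =
     t powr (2 * H * K) + s powr (2 * H * K) - (t powr (2 * H) + s powr (2 * H)) powr K"

definition trifractional_BM ::
    "'a measure \<Rightarrow> real \<Rightarrow> real \<Rightarrow> (real \<Rightarrow> 'a \<Rightarrow> real) \<Rightarrow> bool" where
  "trifractional_BM M H K X \<longleftrightarrow>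
     0 < H \<and> H < 1 \<and> 0 < K \<and> K < 1 \<and>
     centered_gaussian_process M {0..1} X (tfBm_cov H K)"

(* The path space: PiM T (\<lambda>_. borel) consists of the real functions on T (extended by undefined
   outside T) with the \<sigma>-algebra generated by the coordinate maps. *)
definition path_law :: "'a measure \<Rightarrow> 'i set \<Rightarrow> ('i \<Rightarrow> 'a \<Rightarrow> real) \<Rightarrow> ('i \<Rightarrow> real) measure" where
  "path_law M T X = distr M (PiM T (\<lambda>_. borel)) (\<lambda>\<omega>. \<lambda>t\<in>T. X t \<omega>)"

definition singular_prob_measures :: "'b measure \<Rightarrow> 'b measure \<Rightarrow> bool" where
  "singular_prob_measures P Q \<longleftrightarrow>
     prob_space P \<and> prob_space Q \<and> sets P = sets Q \<and>
     (\<exists>A\<in>sets P. emeasure P A = 1 \<and> emeasure Q A = 0)"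

end

theory Submission
  imports Defs
begin

text \<open>
  A trifractional Brownian motion has \<open>Var (X t) = (2 - 2 powr K) * t powr (2 * H * K)\<close>, so near the
  origin \<open>X t\<close> is of size \<open>t powr (H * K)\<close>, and the product \<open>H * K\<close> can be read off almost every path
  from its behaviour at \<open>0\<close>. No independence is needed for this, because both deviations from the
  typical size are rare enough along \<open>t = 2 powr - n\<close>: for an exponent \<open>g\<close>,

  \<^item> if \<open>g < H * K\<close>, Chebyshev's inequality bounds the probability of \<open>\<bar>X t\<bar> > t powr g\<close> by a multiple
    of \<open>t powr (2 * (H * K - g))\<close>;

  \<^item> if \<open>g > H * K\<close>, boundedness of the normal density bounds the probability of
    \<open>\<bar>X t\<bar> \<le> t powr g\<close> by a multiple of \<open>t powr (g - H * K)\<close>.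

  Both bounds are geometric in \<open>n\<close>, so by the first Borel-Cantelli lemma the paths eventually stay
  below, respectively above, \<open>t powr g\<close>. If the products of the two processes differ, any \<open>g\<close> strictly
  between them makes the event ``eventually \<open>\<bar>x t\<bar> > t powr g\<close>'' of full measure for one law and null
  for the other.
\<close>

lemma centered_normal_tail:
  assumes "prob_space M" and Y: "distributed M lborel Y (normal_density 0 \<sigma>)"
    and "0 < \<sigma>" "0 < r"
  shows "measure M {\<omega> \<in> space M. r < \<bar>Y \<omega>\<bar>} \<le> \<sigma>\<^sup>2 / r\<^sup>2"
proof -
  interpret prob_space M by fact
  have Ym[measurable]: "Y \<in> borel_measurable M"
    using distributed_measurable[OF Y] by simp
  have E: "expectation Y = 0" and V: "variance Y = \<sigma>\<^sup>2"
    using normal_distributed_expectation[OF \<open>0 < \<sigma>\<close> Y]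
      normal_distributed_variance[OF \<open>0 < \<sigma>\<close> Y] by simp_all
  \<comment> \<open>A non-integrable square would have Bochner integral \<open>0\<close>, but its integral is \<open>\<sigma>\<^sup>2 > 0\<close>.\<close>
  have "integrable M (\<lambda>\<omega>. (Y \<omega>)\<^sup>2)"
  proof (rule ccontr)
    assume "\<not> integrable M (\<lambda>\<omega>. (Y \<omega>)\<^sup>2)"
    then have "expectation (\<lambda>\<omega>. (Y \<omega>)\<^sup>2) = 0"
      by (rule not_integrable_integral_eq)
    with V E \<open>0 < \<sigma>\<close> show False by simp
  qed
  then have "prob {\<omega> \<in> space M. r \<le> \<bar>Y \<omega> - expectation Y\<bar>} \<le> variance Y / r\<^sup>2"
    using \<open>0 < r\<close> by (intro Chebyshev_inequality) auto
  moreover have "prob {\<omega> \<in> space M. r < \<bar>Y \<omega>\<bar>} \<le> prob {\<omega> \<in> space M. r \<le> \<bar>Y \<omega>\<bar>}"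
    by (intro finite_measure_mono) auto
  ultimately show ?thesis using V E by simp
qed

text \<open>The normal density is bounded by \<open>1 / \<sigma>\<close>, and the ball is an interval of length \<open>2 * r\<close>.\<close>

lemma centered_normal_small_ball:
  assumes "prob_space M" and Y: "distributed M lborel Y (normal_density 0 \<sigma>)"
    and "0 < \<sigma>" "0 \<le> r"
  shows "measure M {\<omega> \<in> space M. \<bar>Y \<omega>\<bar> \<le> r} \<le> 2 * r / \<sigma>"
proof -
  interpret prob_space M by fact
  have dens: "normal_density 0 \<sigma> x \<le> 1 / \<sigma>" for x
  proof -
    have "\<sigma> * 1 \<le> \<sigma> * sqrt (2 * pi)"
      using \<open>0 < \<sigma>\<close> pi_gt3 by (intro mult_left_mono) auto
    then have "1 / sqrt (2 * pi * \<sigma>\<^sup>2) \<le> 1 / \<sigma>"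
      using \<open>0 < \<sigma>\<close> by (intro divide_left_mono) (auto simp: real_sqrt_mult)
    moreover have "exp (- x\<^sup>2 / (2 * \<sigma>\<^sup>2)) \<le> 1" by simp
    ultimately have "1 / sqrt (2 * pi * \<sigma>\<^sup>2) * exp (- x\<^sup>2 / (2 * \<sigma>\<^sup>2)) \<le> 1 / \<sigma> * 1"
      using \<open>0 < \<sigma>\<close> by (intro mult_mono) auto
    then show ?thesis by (simp add: normal_density_def)
  qed
  have "emeasure M {\<omega> \<in> space M. \<bar>Y \<omega>\<bar> \<le> r} = emeasure M (Y -` {-r..r} \<inter> space M)"
    by (intro arg_cong[where f="emeasure M"]) auto
  also have "\<dots> = (\<integral>\<^sup>+x. ennreal (normal_density 0 \<sigma> x) * indicator {-r..r} x \<partial>lborel)"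
    using distributed_emeasure[OF Y] by simp
  also have "\<dots> \<le> (\<integral>\<^sup>+x. ennreal (1 / \<sigma>) * indicator {-r..r} x \<partial>lborel)"
    using dens by (intro nn_integral_mono) (auto split: split_indicator intro: ennreal_leI)
  also have "\<dots> = ennreal (1 / \<sigma>) * ennreal (2 * r)"
    using \<open>0 \<le> r\<close> by (simp add: nn_integral_cmult_indicator)
  also have "\<dots> = ennreal (2 * r / \<sigma>)"
    using \<open>0 < \<sigma>\<close> \<open>0 \<le> r\<close> by (simp add: ennreal_mult[symmetric])
  finally show ?thesis
    using \<open>0 < \<sigma>\<close> \<open>0 \<le> r\<close> by (simp add: emeasure_eq_measure)
qed

lemma trifractional_BM_prob_space: "trifractional_BM M H K X \<Longrightarrow> prob_space M"
  by (simp add: trifractional_BM_def centered_gaussian_process_def gaussian_process_def)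

lemma gaussian_process_gaussian_rv:
  assumes "gaussian_process M T X" "t \<in> T"
  shows "gaussian_rv M (X t)"
proof -
  have "gaussian_rv M (\<lambda>\<omega>. \<Sum>s\<in>{t}. 1 * X s \<omega>)"
    using assms(1)[unfolded gaussian_process_def, THEN conjunct2, rule_format, of "{t}" "\<lambda>_. 1"]
      assms(2) by simp
  then show ?thesis by simp
qed

lemma trifractional_BM_moments:
  assumes "trifractional_BM M H K X" and t: "t \<in> {0..1}"
  shows "gaussian_rv M (X t)" and "(\<integral>\<omega>. X t \<omega> \<partial>M) = 0"
    and "covariance M (X t) (X t) = tfBm_cov H K t t"
proof -
  have "gaussian_process M {0..1} X" and mean: "\<forall>t\<in>{0..1}. (\<integral>\<omega>. X t \<omega> \<partial>M) = 0"
    and cov: "\<forall>s\<in>{0..1}. \<forall>t\<in>{0..1}. covariance M (X s) (X t) = tfBm_cov H K s t"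
    using assms(1) unfolding trifractional_BM_def centered_gaussian_process_def by blast+
  then show "gaussian_rv M (X t)"
    using t by (intro gaussian_process_gaussian_rv)
  show "(\<integral>\<omega>. X t \<omega> \<partial>M) = 0"
    using mean t by (rule bspec)
  show "covariance M (X t) (X t) = tfBm_cov H K t t"
    using bspec[OF cov t] t by (rule bspec)
qed

lemma trifractional_BM_measurable:
  "trifractional_BM M H K X \<Longrightarrow> t \<in> {0..1} \<Longrightarrow> X t \<in> borel_measurable M"
  using trifractional_BM_moments(1) unfolding gaussian_rv_def by blast

lemma tfBm_cov_diag: "tfBm_cov H K t t = (2 - 2 powr K) * t powr (2 * H * K)"
proof -
  have "(t powr (2 * H) + t powr (2 * H)) powr K = (2 * t powr (2 * H)) powr K"
    by simp
  also have "\<dots> = 2 powr K * t powr (2 * H * K)"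
    by (simp add: powr_mult powr_powr)
  finally show ?thesis
    by (simp add: tfBm_cov_def left_diff_distrib)
qed

lemma trifractional_BM_scale_pos:
  assumes "trifractional_BM M H K X"
  shows "0 < 2 - 2 powr K"
proof -
  have "(2::real) powr K < 2 powr 1"
    using assms by (intro powr_less_mono) (auto simp: trifractional_BM_def)
  then show ?thesis by simp
qed

text \<open>The marginal law is nondegenerate because \<open>2 powr K < 2\<close>; this excludes the point-mass branch
  of \<open>normal_law\<close>, whose variance would be \<open>0\<close>.\<close>

lemma trifractional_BM_marginal:
  assumes tf: "trifractional_BM M H K X" and t: "0 < t" "t \<le> 1"
  shows "distributed M lborel (X t) (normal_density 0 (sqrt (2 - 2 powr K) * t powr (H * K)))"
proof -
  interpret prob_space M by (rule trifractional_BM_prob_space[OF tf])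
  have [measurable]: "X t \<in> borel_measurable M"
    using t by (intro trifractional_BM_measurable[OF tf]) simp
  have t01: "t \<in> {0..1}" using t by simp
  note E = trifractional_BM_moments(2)[OF tf t01] and C = trifractional_BM_moments(3)[OF tf t01]
  from trifractional_BM_moments(1)[OF tf t01] obtain m \<sigma> where \<sigma>: "0 \<le> \<sigma>" and law: "distr M borel (X t) = normal_law m \<sigma>"
    unfolding gaussian_rv_def by blast
  have V: "expectation (\<lambda>\<omega>. (X t \<omega>)\<^sup>2) = (2 - 2 powr K) * t powr (2 * H * K)"
    using C E t by (simp add: covariance_def tfBm_cov_diag power2_eq_square)
  have pos: "0 < (2 - 2 powr K) * t powr (2 * H * K)"
    using trifractional_BM_scale_pos[OF tf] t by simp
  have "\<sigma> \<noteq> 0"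
  proof
    assume "\<sigma> = 0"
    then have d: "distr M borel (X t) = return borel m"
      using law by (simp add: normal_law_def)
    have "expectation (X t) = (\<integral>x. x \<partial>distr M borel (X t))"
      by (simp add: integral_distr)
    then have "m = 0" using E d by (simp add: integral_return)
    have "expectation (\<lambda>\<omega>. (X t \<omega>)\<^sup>2) = (\<integral>x. x\<^sup>2 \<partial>distr M borel (X t))"
      by (simp add: integral_distr)
    also have "\<dots> = 0" using d \<open>m = 0\<close> by (simp add: integral_return)
    finally show False using V pos by linarith
  qed
  with \<sigma> have "0 < \<sigma>" by simp
  have "distr M lborel (X t) = distr M borel (X t)"
    by (intro distr_cong) auto
  then have D: "distributed M lborel (X t) (normal_density m \<sigma>)"
    using law \<open>\<sigma> \<noteq> 0\<close> by (simp add: distributed_def normal_law_def)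
  have "m = 0" using normal_distributed_expectation[OF \<open>0 < \<sigma>\<close> D] E by simp
  have "\<sigma>\<^sup>2 = (2 - 2 powr K) * t powr (2 * H * K)"
    using normal_distributed_variance[OF \<open>0 < \<sigma>\<close> D] V E by simp
  also have "\<dots> = (sqrt (2 - 2 powr K) * t powr (H * K))\<^sup>2"
    using trifractional_BM_scale_pos[OF tf]
    by (simp add: power_mult_distrib mult.assoc power2_eq_square[of "t powr _"] flip: powr_add)
  finally have "\<sigma> = sqrt (2 - 2 powr K) * t powr (H * K)"
    by (rule power2_eq_imp_eq) (use \<open>0 < \<sigma>\<close> trifractional_BM_scale_pos[OF tf] in simp_all)
  with D \<open>m = 0\<close> show ?thesis by simp
qed

lemma summable_powr_dyadic:
  fixes p :: real
  assumes "0 < p"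
  shows "summable (\<lambda>n. ((1/2::real) ^ n) powr p)"
proof -
  have "((1/2::real) ^ n) powr p = ((1/2) powr p) ^ n" for n
  proof -
    have "((1/2::real) ^ n) powr p = ((1/2) powr real n) powr p"
      by (subst powr_realpow) auto
    also have "\<dots> = ((1/2) powr p) powr real n"
      by (simp only: powr_powr mult.commute)
    also have "\<dots> = ((1/2) powr p) ^ n"
      by (rule powr_realpow) simp
    finally show ?thesis .
  qed
  moreover have "(1/2::real) powr p < 1"
    using powr_less_mono2[of p "1/2" 1] assms by simp
  ultimately show ?thesis by (simp only:) (rule summable_geometric, simp)
qed

text \<open>Chebyshev's inequality and the first Borel-Cantelli lemma along \<open>t = (1/2)^n\<close>.\<close>

lemma trifractional_BM_eventually_below:
  assumes tf: "trifractional_BM M H K X" and g: "g < H * K"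
  shows "AE \<omega> in M. eventually (\<lambda>n. \<bar>X ((1/2)^n) \<omega>\<bar> \<le> ((1/2)^n) powr g) sequentially"
proof -
  interpret prob_space M by (rule trifractional_BM_prob_space[OF tf])
  have [measurable]: "X ((1/2)^n) \<in> borel_measurable M" for n
    using trifractional_BM_measurable[OF tf] by (simp add: power_le_one)
  let ?B = "\<lambda>n. {\<omega> \<in> space M. ((1/2)^n) powr g < \<bar>X ((1/2)^n) \<omega>\<bar>}"
  have bound: "prob (?B n) \<le> (2 - 2 powr K) * ((1/2)^n) powr (2 * (H * K - g))" for n
  proof -
    define t :: real where "t = (1/2)^n"
    have t: "0 < t" "t \<le> 1" by (simp_all add: t_def power_le_one)
    have "prob {\<omega> \<in> space M. t powr g < \<bar>X t \<omega>\<bar>}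
        \<le> (sqrt (2 - 2 powr K) * t powr (H * K))\<^sup>2 / (t powr g)\<^sup>2"
      using trifractional_BM_scale_pos[OF tf] t
      by (intro centered_normal_tail trifractional_BM_marginal[OF tf] prob_space_axioms) auto
    also have "\<dots> = (2 - 2 powr K) * (t powr (H * K - g))\<^sup>2"
      using trifractional_BM_scale_pos[OF tf]
      by (simp add: power_mult_distrib powr_diff power_divide)
    also have "(t powr (H * K - g))\<^sup>2 = t powr (2 * (H * K - g))"
      by (simp add: power2_eq_square flip: powr_add)
    finally show ?thesis by (simp add: t_def)
  qed
  have "summable (\<lambda>n. prob (?B n))"
  proof (rule summable_comparison_test')
    show "summable (\<lambda>n. (2 - 2 powr K) * ((1/2)^n) powr (2 * (H * K - g)))"
      using g by (intro summable_mult summable_powr_dyadic) simp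
    show "norm (prob (?B n)) \<le> (2 - 2 powr K) * ((1/2)^n) powr (2 * (H * K - g))" if "0 \<le> n" for n
      using bound[of n] by (simp only: real_norm_def abs_of_nonneg measure_nonneg)
  qed
  then have "AE \<omega> in M. eventually (\<lambda>n. \<omega> \<in> space M - ?B n) sequentially"
    by (intro borel_cantelli_AE1) (auto simp: emeasure_eq_measure)
  then show ?thesis
    by eventually_elim (auto elim!: eventually_mono)
qed

text \<open>The same argument with the small-ball bound in place of Chebyshev's inequality.\<close>

lemma trifractional_BM_eventually_above:
  assumes tf: "trifractional_BM M H K X" and g: "H * K < g"
  shows "AE \<omega> in M. eventually (\<lambda>n. ((1/2)^n) powr g < \<bar>X ((1/2)^n) \<omega>\<bar>) sequentially"
proof -
  interpret prob_space M by (rule trifractional_BM_prob_space[OF tf])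
  have [measurable]: "X ((1/2)^n) \<in> borel_measurable M" for n
    using trifractional_BM_measurable[OF tf] by (simp add: power_le_one)
  let ?B = "\<lambda>n. {\<omega> \<in> space M. \<bar>X ((1/2)^n) \<omega>\<bar> \<le> ((1/2)^n) powr g}"
  have bound: "prob (?B n) \<le> 2 / sqrt (2 - 2 powr K) * ((1/2)^n) powr (g - H * K)" for n
  proof -
    define t :: real where "t = (1/2)^n"
    have t: "0 < t" "t \<le> 1" by (simp_all add: t_def power_le_one)
    have "prob {\<omega> \<in> space M. \<bar>X t \<omega>\<bar> \<le> t powr g}
        \<le> 2 * t powr g / (sqrt (2 - 2 powr K) * t powr (H * K))"
      using trifractional_BM_scale_pos[OF tf] t
      by (intro centered_normal_small_ball trifractional_BM_marginal[OF tf] prob_space_axioms) auto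
    also have "\<dots> = 2 / sqrt (2 - 2 powr K) * t powr (g - H * K)"
      by (simp add: powr_diff)
    finally show ?thesis by (simp add: t_def)
  qed
  have "summable (\<lambda>n. prob (?B n))"
  proof (rule summable_comparison_test')
    show "summable (\<lambda>n. 2 / sqrt (2 - 2 powr K) * ((1/2)^n) powr (g - H * K))"
      using g by (intro summable_mult summable_powr_dyadic) simp
    show "norm (prob (?B n)) \<le> 2 / sqrt (2 - 2 powr K) * ((1/2)^n) powr (g - H * K)" if "0 \<le> n" for n
      using bound[of n] by (simp only: real_norm_def abs_of_nonneg measure_nonneg)
  qed
  then have "AE \<omega> in M. eventually (\<lambda>n. \<omega> \<in> space M - ?B n) sequentially"
    by (intro borel_cantelli_AE1) (auto simp: emeasure_eq_measure)
  then show ?thesis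
    by eventually_elim (auto elim!: eventually_mono)
qed

lemma singular_prob_measures_sym:
  assumes "singular_prob_measures P Q"
  shows "singular_prob_measures Q P"
proof -
  obtain A where A: "prob_space P" "prob_space Q" "sets P = sets Q" "A \<in> sets P"
      "emeasure P A = 1" "emeasure Q A = 0"
    using assms unfolding singular_prob_measures_def by blast
  have "emeasure Q (space Q - A) = 1"
    using A by (simp add: emeasure_compl prob_space.emeasure_space_1)
  moreover have "emeasure P (space Q - A) = 0"
    unfolding sets_eq_imp_space_eq[OF A(3), symmetric]
    using A by (simp add: emeasure_compl prob_space.emeasure_space_1)
  ultimately show ?thesis
    using A unfolding singular_prob_measures_def by (intro conjI bexI[of _ "space Q - A"]) auto
qed

text \<open>By the symmetry of singularity it suffices to compare the two processes when the first has the
  smaller product, hence the larger paths near the origin.\<close>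

lemma trifractional_BM_singular_of_less:
  assumes tf1: "trifractional_BM M1 H1 K1 X1" and tf2: "trifractional_BM M2 H2 K2 X2"
    and less: "H1 * K1 < H2 * K2"
  shows "singular_prob_measures (path_law M1 {0..1} X1) (path_law M2 {0..1} X2)"
proof -
  let ?N = "PiM {0..1::real} (\<lambda>_. borel :: real measure)"
  interpret M1: prob_space M1 by (rule trifractional_BM_prob_space[OF tf1])
  interpret M2: prob_space M2 by (rule trifractional_BM_prob_space[OF tf2])
  have X1[measurable]: "(\<lambda>\<omega>. \<lambda>t\<in>{0..1}. X1 t \<omega>) \<in> measurable M1 ?N"
    by (intro measurable_restrict trifractional_BM_measurable[OF tf1])
  have X2[measurable]: "(\<lambda>\<omega>. \<lambda>t\<in>{0..1}. X2 t \<omega>) \<in> measurable M2 ?N"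
    by (intro measurable_restrict trifractional_BM_measurable[OF tf2])
  have P1: "prob_space (path_law M1 {0..1} X1)" and P2: "prob_space (path_law M2 {0..1} X2)"
    unfolding path_law_def by (simp_all add: M1.prob_space_distr M2.prob_space_distr)
  obtain g where g: "H1 * K1 < g" "g < H2 * K2"
    using dense[OF less] by blast
  define large where "large x \<longleftrightarrow> eventually (\<lambda>n. ((1/2)^n) powr g < \<bar>x ((1/2)^n)\<bar>) sequentially"
    for x :: "real \<Rightarrow> real"
  have dyadic: "(1/2::real)^n \<in> {0..1}" for n
    by (simp add: power_le_one)
  have [measurable]: "(\<lambda>x. x ((1/2)^n)) \<in> borel_measurable ?N" for n
    by (rule measurable_component_singleton[OF dyadic])
  \<comment> \<open>Only countably many coordinates enter \<open>large\<close>, so it is an event of the path space.\<close>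
  have large_sets: "{x \<in> space ?N. large x} \<in> sets ?N"
    unfolding large_def eventually_sequentially by measurable
  have restr: "large (\<lambda>t\<in>{0..1}. x t) \<longleftrightarrow> large x" for x
    using dyadic by (simp add: large_def restrict_def)
  have "AE x in path_law M1 {0..1} X1. large x"
    unfolding path_law_def AE_distr_iff[OF X1 large_sets] restr
    using trifractional_BM_eventually_above[OF tf1 g(1)] by (simp add: large_def)
  then have "emeasure (path_law M1 {0..1} X1) {x \<in> space ?N. large x} = 1"
    using large_sets by (intro prob_space.emeasure_eq_1_AE[OF P1]) (auto simp: path_law_def)
  moreover have "AE \<omega> in M2. \<not> large (\<lambda>t. X2 t \<omega>)"
    using trifractional_BM_eventually_below[OF tf2 g(2)]
  proof eventually_elim
    case (elim \<omega>)
    show ?case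
    proof
      assume "large (\<lambda>t. X2 t \<omega>)"
      with elim have "eventually (\<lambda>n::nat. False) sequentially"
        unfolding large_def by eventually_elim simp
      then show False by simp
    qed
  qed
  then have "AE x in path_law M2 {0..1} X2. \<not> large x"
    unfolding path_law_def
    using large_sets by (subst AE_distr_iff[OF X2]) (auto simp: restr)
  then have "emeasure (path_law M2 {0..1} X2) {x \<in> space ?N. large x} = 0"
    using large_sets by (subst (asm) AE_iff_measurable[where N="{x \<in> space ?N. large x}"])
      (auto simp: path_law_def)
  ultimately show ?thesis
    unfolding singular_prob_measures_def using P1 P2 large_sets by (auto simp: path_law_def)
qed

theorem theorem5p2:
  fixes M1 :: "'a measure" and M2 :: "'b measure"
    and X1 :: "real \<Rightarrow> 'a \<Rightarrow> real" and X2 :: "real \<Rightarrow> 'b \<Rightarrow> real"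
    and H1 K1 H2 K2 :: real
  assumes "0 < H1" "H1 < 1" "0 < K1" "K1 < 1"
    and "0 < H2" "H2 < 1" "0 < K2" "K2 < 1"
    and "H1 * K1 \<le> 1 / 2" and "H2 * K2 \<le> 1 / 2"
    and "trifractional_BM M1 H1 K1 X1"
    and "trifractional_BM M2 H2 K2 X2"
    and "H1 * K1 \<noteq> H2 * K2"
  shows "singular_prob_measures (path_law M1 {0..1} X1) (path_law M2 {0..1} X2)"
proof (cases "H1 * K1 < H2 * K2")
  case True
  with assms show ?thesis by (intro trifractional_BM_singular_of_less)
next
  case False
  with assms have "H2 * K2 < H1 * K1" by simp
  with assms show ?thesis
    by (intro singular_prob_measures_sym[OF trifractional_BM_singular_of_less])
qed

end
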